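(* Let $F$ and $G$ be nonempty graphs without isolated vertices such that there is no graph homomorphism from $G$ to $F$. Then $$\mathrm{ex}_F(n,G)\ge \frac{1}{v(F)^2}n^2-o(n^2)\quad (n\to\infty).$$
   Context: All graphs are simple; $v(F)$ is the number of vertices of $F$. $\mathrm{ex}_F(n,G)$ is the maximum $k$ such that there exist $k$ pairwise edge-disjoint subgraphs $F_1,\dots,F_k$ of $K_n$, each isomorphic to $F$, such that $\bigcup_i F_i$ contains no subgraph $G'$ isomorphic to $G$ with $|E(G')\cap E(F_i)|\le 1$ for every $i$. *)

theory Defs
  imports Complex_Main "HOL-Library.Landau_Symbols"
begin

record 'a graph =
  verts :: "'a set"
  edges :: "'a set set"

definition simple_graph :: "'a graph \<Rightarrow> bool" where
  "simple_graph G \<longleftrightarrow>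
     finite (verts G) \<and> (\<forall>e\<in>edges G. e \<subseteq> verts G \<and> card e = 2)"

definition no_isolated_vertices :: "'a graph \<Rightarrow> bool" where
  "no_isolated_vertices G \<longleftrightarrow> (\<forall>v\<in>verts G. \<exists>e\<in>edges G. v \<in> e)"

definition subgraph :: "'a graph \<Rightarrow> 'a graph \<Rightarrow> bool" where
  "subgraph H G \<longleftrightarrow> simple_graph H \<and> verts H \<subseteq> verts G \<and> edges H \<subseteq> edges G"

(* Edges have two elements, so {f u, f v} \<in> edges H forces f u \<noteq> f v. *)
definition graph_hom :: "('a \<Rightarrow> 'b) \<Rightarrow> 'a graph \<Rightarrow> 'b graph \<Rightarrow> bool" where
  "graph_hom f G H \<longleftrightarrow>
     f ` verts G \<subseteq> verts H \<and> (\<forall>u v. {u, v} \<in> edges G \<longrightarrow> {f u, f v} \<in> edges H)"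

definition graph_iso :: "'a graph \<Rightarrow> 'b graph \<Rightarrow> bool" where
  "graph_iso G H \<longleftrightarrow>
     (\<exists>f. bij_betw f (verts G) (verts H) \<and>
          (\<forall>u\<in>verts G. \<forall>v\<in>verts G. {u, v} \<in> edges G \<longleftrightarrow> {f u, f v} \<in> edges H))"

definition complete_graph :: "nat \<Rightarrow> nat graph" where
  "complete_graph n = \<lparr>verts = {..<n}, edges = {e. e \<subseteq> {..<n} \<and> card e = 2}\<rparr>"

definition graph_union :: "('i \<Rightarrow> 'a graph) \<Rightarrow> 'i set \<Rightarrow> 'a graph" where
  "graph_union Fs I = \<lparr>verts = (\<Union>i\<in>I. verts (Fs i)), edges = (\<Union>i\<in>I. edges (Fs i))\<rparr>"

definition edge_disjoint_copies :: "'a graph \<Rightarrow> nat \<Rightarrow> nat \<Rightarrow> (nat \<Rightarrow> nat graph) \<Rightarrow> bool" where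
  "edge_disjoint_copies F n k Fs \<longleftrightarrow>
     (\<forall>i<k. subgraph (Fs i) (complete_graph n) \<and> graph_iso F (Fs i)) \<and>
     (\<forall>i<k. \<forall>j<k. i \<noteq> j \<longrightarrow> edges (Fs i) \<inter> edges (Fs j) = {})"

definition has_rainbow_copy :: "'b graph \<Rightarrow> nat \<Rightarrow> (nat \<Rightarrow> nat graph) \<Rightarrow> bool" where
  "has_rainbow_copy G k Fs \<longleftrightarrow>
     (\<exists>G'. subgraph G' (graph_union Fs {..<k}) \<and> graph_iso G G' \<and>
           (\<forall>i<k. card (edges G' \<inter> edges (Fs i)) \<le> 1))"

(* The maximum exists as soon as F has an edge and G has a vertex;
   see finite_packing_sizes and zero_packing_size. *)
definition ex_packing :: "'a graph \<Rightarrow> nat \<Rightarrow> 'b graph \<Rightarrow> nat" where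
  "ex_packing F n G =
     Max {k. \<exists>Fs. edge_disjoint_copies F n k Fs \<and> \<not> has_rainbow_copy G k Fs}"

lemma finite_packing_sizes:
  assumes "simple_graph F" and "edges F \<noteq> {}"
  shows "finite {k. \<exists>Fs. edge_disjoint_copies F n k Fs \<and> \<not> has_rainbow_copy G k Fs}"
proof -
  let ?E = "edges (complete_graph n)"
  have fin: "finite ?E"
    by (simp add: complete_graph_def)
  have "k \<le> card ?E" if P: "edge_disjoint_copies F n k Fs" for k Fs
  proof -
    have "\<exists>e. e \<in> edges (Fs i)" if i: "i < k" for i
    proof -
      obtain f where f: "bij_betw f (verts F) (verts (Fs i))"
        "\<forall>u\<in>verts F. \<forall>v\<in>verts F. {u, v} \<in> edges F \<longleftrightarrow> {f u, f v} \<in> edges (Fs i)"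
        using P i by (auto simp: edge_disjoint_copies_def graph_iso_def)
      obtain u v where "{u, v} \<in> edges F"
        using assms unfolding simple_graph_def card_2_iff by (metis all_not_in_conv)
      moreover from this have "u \<in> verts F" "v \<in> verts F"
        using assms by (auto simp: simple_graph_def)
      ultimately show ?thesis using f(2) by blast
    qed
    then obtain h where h: "\<And>i. i < k \<Longrightarrow> h i \<in> edges (Fs i)"
      by metis
    have "inj_on h {..<k}"
      using h P unfolding inj_on_def edge_disjoint_copies_def by (metis IntI empty_iff lessThan_iff)
    moreover have "h ` {..<k} \<subseteq> ?E"
      using h P by (fastforce simp: edge_disjoint_copies_def subgraph_def)
    ultimately show ?thesis
      using card_inj_on_le[OF _ _ fin] by fastforce
  qed
  then show ?thesis
    by (intro finite_subset[OF _ finite_atMost[of "card ?E"]]) auto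
qed

lemma zero_packing_size:
  assumes "verts G \<noteq> {}"
  shows "0 \<in> {k. \<exists>Fs. edge_disjoint_copies F n k Fs \<and> \<not> has_rainbow_copy G k Fs}"
  using assms
  by (auto simp: edge_disjoint_copies_def has_rainbow_copy_def subgraph_def graph_union_def
      graph_iso_def bij_betw_def)

end

theory Submission
  imports Defs "HOL-Number_Theory.Cong"
begin

text \<open>
  Blow up every vertex of \<open>F\<close> to a class of \<open>m\<close> vertices. The blow-up maps homomorphically
  to \<open>F\<close>, so none of its subgraphs is isomorphic to \<open>G\<close>. If \<open>m\<close> is coprime
  to every positive integer up to \<open>v(F)\<close>, the \<open>m\<^sup>2\<close> lines \<open>i \<mapsto> a + b i\<close> modulo \<open>m\<close> pick one vertex from
  each class and any two lines agree in at most one class, so they give \<open>m\<^sup>2\<close> edge-disjoint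
  copies of \<open>F\<close>. Taking \<open>m \<equiv> 1\<close> modulo \<open>v(F)!\<close> allows \<open>m \<ge> n / v(F) - O(1)\<close>.
\<close>

section \<open>Copies of a graph as injective images\<close>

definition image_graph :: "('a \<Rightarrow> 'b) \<Rightarrow> 'a graph \<Rightarrow> 'b graph" where
  "image_graph f G = \<lparr>verts = f ` verts G, edges = (`) f ` edges G\<rparr>"

lemma simple_graph_edgeE:
  assumes "simple_graph G" and "e \<in> edges G"
  obtains u v where "e = {u, v}" "u \<noteq> v" "u \<in> verts G" "v \<in> verts G"
  using assms unfolding simple_graph_def card_2_iff by (metis insert_subset)

lemma graph_iso_image_graph:
  assumes "simple_graph G" and inj: "inj_on f (verts G)"
  shows "graph_iso G (image_graph f G)"
  unfolding graph_iso_def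
proof (intro exI[of _ f] conjI ballI iffI)
  show "bij_betw f (verts G) (verts (image_graph f G))"
    using inj by (simp add: image_graph_def bij_betw_def)
next
  fix u v assume "{u, v} \<in> edges G"
  then have "f ` {u, v} \<in> (`) f ` edges G" by (rule imageI)
  then show "{f u, f v} \<in> edges (image_graph f G)"
    by (simp add: image_graph_def)
next
  fix u v assume uv: "u \<in> verts G" "v \<in> verts G" "{f u, f v} \<in> edges (image_graph f G)"
  then obtain e where e: "e \<in> edges G" "f ` {u, v} = f ` e"
    by (auto simp: image_graph_def)
  have "e \<subseteq> verts G" using assms(1) e by (auto simp: simple_graph_def)
  then have "{u, v} = e"
    using uv e inj_on_image_eq_iff[OF inj, of "{u, v}" e] by simp
  then show "{u, v} \<in> edges G" using e by simp
qed

lemma subgraph_complete_image_graph: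
  assumes "simple_graph G" and inj: "inj_on f (verts G)" and "f ` verts G \<subseteq> {..<n}"
  shows "subgraph (image_graph f G) (complete_graph n)"
proof -
  have "f ` e \<subseteq> f ` verts G \<and> card (f ` e) = 2" if "e \<in> edges G" for e
    using that assms(1) card_image[OF inj_on_subset[OF inj, of e]]
    by (auto simp: simple_graph_def)
  then show ?thesis
    using assms by (fastforce simp: subgraph_def simple_graph_def image_graph_def complete_graph_def)
qed

text \<open>The common left inverse \<open>p\<close> of all the embeddings \<open>\<phi> i\<close>
  folds their union back onto \<open>F\<close> and sends edges to edges. A copy of \<open>G\<close>
  inside the union, followed by \<open>p\<close>, would therefore be a homomorphism from
  \<open>G\<close> to \<open>F\<close>.\<close>

lemma no_rainbow_copy_image_graphs:
  assumes "simple_graph F" and "simple_graph G" and "\<nexists>f. graph_hom f G F"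
    and retr: "\<And>i v. i < k \<Longrightarrow> v \<in> verts F \<Longrightarrow> p (\<phi> i v) = v"
  shows "\<not> has_rainbow_copy G k (\<lambda>i. image_graph (\<phi> i) F)"
proof
  assume "has_rainbow_copy G k (\<lambda>i. image_graph (\<phi> i) F)"
  then obtain G' g where
    G': "subgraph G' (graph_union (\<lambda>i. image_graph (\<phi> i) F) {..<k})"
    and bij: "bij_betw g (verts G) (verts G')"
    and g: "\<And>u v. u \<in> verts G \<Longrightarrow> v \<in> verts G \<Longrightarrow> {u, v} \<in> edges G \<longleftrightarrow> {g u, g v} \<in> edges G'"
    unfolding has_rainbow_copy_def graph_iso_def by blast
  have "graph_hom (p \<circ> g) G F"
    unfolding graph_hom_def
  proof (intro conjI allI impI)
    show "(p \<circ> g) ` verts G \<subseteq> verts F"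
    proof (intro image_subsetI)
      fix u assume "u \<in> verts G"
      then have "g u \<in> verts G'" using bij by (auto simp: bij_betw_def)
      then obtain i v where "i < k" "v \<in> verts F" "g u = \<phi> i v"
        using G' by (auto simp: subgraph_def graph_union_def image_graph_def)
      then show "(p \<circ> g) u \<in> verts F" using retr by simp
    qed
  next
    fix u v assume uv: "{u, v} \<in> edges G"
    then have "u \<in> verts G" "v \<in> verts G"
      using assms(2) by (auto simp: simple_graph_def)
    then have "{g u, g v} \<in> edges G'" using uv g by blast
    then obtain i e where ie: "i < k" "e \<in> edges F" "{g u, g v} = \<phi> i ` e"
      using G' by (auto simp: subgraph_def graph_union_def image_graph_def)
    have "e \<subseteq> verts F" using ie assms(1) by (auto simp: simple_graph_def)
    then have "p ` \<phi> i ` e = e"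
      using retr[OF ie(1)] by (force simp: image_image)
    then have "{(p \<circ> g) u, (p \<circ> g) v} = e"
      using arg_cong[OF ie(3), of "(`) p"] by simp
    then show "{(p \<circ> g) u, (p \<circ> g) v} \<in> edges F" using ie by simp
  qed
  then show False using assms(3) by blast
qed

text \<open>Applying \<open>p\<close> to an endpoint of a shared edge gives the same vertex of
  \<open>F\<close> whichever copy it is seen in. So two copies sharing an edge come from embeddings
  that agree at both of its ends, which \<open>agree\<close> allows only for equal indices.\<close>

lemma edge_disjoint_copies_image_graphs:
  assumes F: "simple_graph F"
    and retr: "\<And>i v. i < k \<Longrightarrow> v \<in> verts F \<Longrightarrow> p (\<phi> i v) = v"
    and range: "\<And>i v. i < k \<Longrightarrow> v \<in> verts F \<Longrightarrow> \<phi> i v < n"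
    and agree: "\<And>i j u v. \<lbrakk>i < k; j < k; u \<in> verts F; v \<in> verts F; u \<noteq> v;
                  \<phi> i u = \<phi> j u; \<phi> i v = \<phi> j v\<rbrakk> \<Longrightarrow> i = j"
  shows "edge_disjoint_copies F n k (\<lambda>i. image_graph (\<phi> i) F)"
proof -
  have inj: "inj_on (\<phi> i) (verts F)" if "i < k" for i
    using retr[OF that] by (rule inj_on_inverseI)
  have "i = j" if ij: "i < k" "j < k"
    and e: "e \<in> edges F" "e' \<in> edges F" "\<phi> i ` e = \<phi> j ` e'" for i j e e'
  proof -
    obtain u v where uv: "e = {u, v}" "u \<noteq> v" "u \<in> verts F" "v \<in> verts F"
      using simple_graph_edgeE[OF F e(1)] by blast
    have e': "e' \<subseteq> verts F" using F e by (auto simp: simple_graph_def)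
    have "\<phi> i w = \<phi> j w" if w: "w \<in> e" for w
    proof -
      obtain w' where w': "w' \<in> e'" "\<phi> i w = \<phi> j w'" using e(3) w by blast
      have "w = p (\<phi> i w)" using retr[OF ij(1)] w uv by auto
      also have "\<dots> = w'" using w' e' retr[OF ij(2)] by auto
      finally show ?thesis using w' by simp
    qed
    then show "i = j" using agree[OF ij uv(3,4,2)] uv(1) by simp
  qed
  then have "edges (image_graph (\<phi> i) F) \<inter> edges (image_graph (\<phi> j) F) = {}"
    if "i < k" "j < k" "i \<noteq> j" for i j
    using that by (auto simp: image_graph_def)
  moreover have "subgraph (image_graph (\<phi> i) F) (complete_graph n)" if "i < k" for i
    using range that by (intro subgraph_complete_image_graph F inj) auto
  ultimately show ?thesis
    using graph_iso_image_graph[OF F inj] by (simp add: edge_disjoint_copies_def)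
qed

section \<open>Lines modulo m and the blow-up packing\<close>

text \<open>Subtracting the two congruences leaves the slopes multiplied by \<open>j - i\<close>,
  which is invertible modulo \<open>m\<close>; equal slopes then force equal intercepts.\<close>

lemma lines_mod_agree_twice:
  fixes a b a' b' i j m :: nat
  assumes "a < m" "b < m" "a' < m" "b' < m" and "i < j" and cop: "coprime (j - i) m"
    and i: "(a + b * i) mod m = (a' + b' * i) mod m"
    and j: "(a + b * j) mod m = (a' + b' * j) mod m"
  shows "a = a' \<and> b = b'"
proof -
  have ci: "[a + b * i = a' + b' * i] (mod m)" and cj: "[a + b * j = a' + b' * j] (mod m)"
    using i j by (simp_all add: cong_def)
  \<comment> \<open>Subtraction on naturals truncates, so the value at \<open>i\<close> is split off
    as a summand and cancelled instead.\<close>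
  have split: "c + d * j = d * (j - i) + (c + d * i)" for c d
    using \<open>i < j\<close> by (simp add: diff_mult_distrib2 add.commute add.left_commute)
  have "[b * (j - i) + (a + b * i) = b' * (j - i) + (a' + b' * i)] (mod m)"
    using cj unfolding split .
  also have "[b' * (j - i) + (a' + b' * i) = b' * (j - i) + (a + b * i)] (mod m)"
    by (rule cong_add[OF cong_refl cong_sym[OF ci]])
  finally have "[b * (j - i) = b' * (j - i)] (mod m)"
    by (simp only: cong_add_rcancel_nat)
  then have "[b = b'] (mod m)" using cong_mult_rcancel_nat[OF cop] by blast
  then have b: "b = b'" using assms by (simp add: cong_def)
  have "[a = a'] (mod m)" using ci unfolding b by (simp only: cong_add_rcancel_nat)
  then show ?thesis using assms b by (simp add: cong_def)
qed

lemma blowup_packing: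
  fixes F :: "'a graph" and G :: "'b graph"
  assumes F: "simple_graph F" and G: "simple_graph G" and nohom: "\<nexists>f. graph_hom f G F"
    and m: "m > 0" "card (verts F) * m \<le> n"
    and cop: "\<And>d. 0 < d \<Longrightarrow> d < card (verts F) \<Longrightarrow> coprime d m"
  shows "\<exists>Fs. edge_disjoint_copies F n (m\<^sup>2) Fs \<and> \<not> has_rainbow_copy G (m\<^sup>2) Fs"
proof -
  define V where "V = verts F"
  have "finite V" using F by (simp add: simple_graph_def V_def)
  then obtain h where h: "bij_betw h V {0..<card V}"
    using ex_bij_betw_finite_nat by blast
  have hlt: "h v < card V" if "v \<in> V" for v
    using h that by (auto simp: bij_betw_def)
  have hinj: "h u \<noteq> h v" if "u \<in> V" "v \<in> V" "u \<noteq> v" for u v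
    using h that by (auto simp: bij_betw_def inj_on_def)
  \<comment> \<open>An index below \<open>m\<^sup>2\<close> encodes a line: the quotient by
    \<open>m\<close> is its intercept, the remainder its slope.\<close>
  define line where "line t i = (t div m + (t mod m) * i) mod m" for t i
  \<comment> \<open>The class of \<open>v\<close> is the block of \<open>m\<close> consecutive
    numbers from \<open>h v * m\<close> on, so division by \<open>m\<close> recovers
    \<open>h v\<close>.\<close>
  define \<phi> where "\<phi> t v = h v * m + line t (h v)" for t v
  define p where "p x = inv_into V h (x div m)" for x
  have line_lt: "line t i < m" for t i
    using m(1) by (simp add: line_def)
  have retr: "p (\<phi> t v) = v" if "v \<in> verts F" for t v
  proof -
    have "\<phi> t v div m = h v" using line_lt[of t "h v"] m(1) by (simp add: \<phi>_def)
    then show ?thesis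
      using that h by (simp add: p_def V_def bij_betw_def)
  qed
  have range: "\<phi> t v < n" if "v \<in> verts F" for t v
  proof -
    have "\<phi> t v < Suc (h v) * m" using line_lt by (simp add: \<phi>_def)
    also have "\<dots> \<le> card V * m"
      using hlt[of v] that by (intro mult_right_mono) (auto simp: V_def Suc_le_eq)
    finally show ?thesis using m(2) by (simp add: V_def)
  qed
  have two_points: "s = t" if st: "s < m\<^sup>2" "t < m\<^sup>2" and ij: "i < j" "j < card V"
    and eq: "line s i = line t i" "line s j = line t j" for s t i j
  proof -
    \<comment> \<open>The labels \<open>h v\<close> are smaller than \<open>card V\<close>, so
      \<open>j - i\<close> is positive and less than \<open>card V\<close>, as \<open>cop\<close>
      requires.\<close>
    have "coprime (j - i) m" using ij by (intro cop) (auto simp: V_def)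
    then have "s div m = t div m \<and> s mod m = t mod m"
      using st ij(1) eq m(1)
      by (intro lines_mod_agree_twice[of _ _ _ _ _ i j])
         (auto simp: line_def power2_eq_square less_mult_imp_div_less)
    then show "s = t" by (metis div_mult_mod_eq)
  qed
  have agree: "s = t"
    if st: "s < m\<^sup>2" "t < m\<^sup>2" and uv: "u \<in> verts F" "v \<in> verts F" "u \<noteq> v"
      and eq: "\<phi> s u = \<phi> t u" "\<phi> s v = \<phi> t v" for s t u v
  proof (cases "h u < h v")
    case True
    then show ?thesis
      using two_points[OF st True hlt] uv eq by (simp add: \<phi>_def V_def)
  next
    case False
    then have "h v < h u" using hinj[of u v] uv by (simp add: V_def)
    then show ?thesis
      using two_points[OF st _ hlt] uv eq by (simp add: \<phi>_def V_def)
  qed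
  have "edge_disjoint_copies F n (m\<^sup>2) (\<lambda>t. image_graph (\<phi> t) F)"
    using retr range agree by (rule edge_disjoint_copies_image_graphs[OF F])
  moreover have "\<not> has_rainbow_copy G (m\<^sup>2) (\<lambda>t. image_graph (\<phi> t) F)"
    using retr by (rule no_rainbow_copy_image_graphs[OF F G nohom])
  ultimately show ?thesis by blast
qed

section \<open>Choice of the class size and asymptotics\<close>

lemma ex_packing_ge:
  assumes "simple_graph F" and "edges F \<noteq> {}"
    and "edge_disjoint_copies F n k Fs" and "\<not> has_rainbow_copy G k Fs"
  shows "k \<le> ex_packing F n G"
  unfolding ex_packing_def using assms by (intro Max_ge finite_packing_sizes) auto

lemma exists_large_size_coprime_upto:
  fixes k q :: nat
  assumes "q > 0"
  obtains m where "0 < m" "m \<le> q" "q < m + fact k"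
    "\<And>d. 0 < d \<Longrightarrow> d \<le> k \<Longrightarrow> coprime d m"
proof
  define N where "N = (fact k :: nat)"
  \<comment> \<open>The largest number up to \<open>q\<close> that is 1 modulo \<open>N\<close>.
    Every positive \<open>d \<le> k\<close> divides \<open>N\<close>, and a common divisor of
    \<open>N\<close> and \<open>m\<close> divides 1.\<close>
  define m where "m = (q - 1) div N * N + 1"
  have N: "N > 0" by (simp add: N_def)
  have dm: "(q - 1) div N * N + (q - 1) mod N = q - 1" by simp
  show "0 < m" by (simp add: m_def)
  show "m \<le> q" using dm assms unfolding m_def by linarith
  show "q < m + fact k"
    using dm assms mod_less_divisor[OF N, of "q - 1"] unfolding N_def[symmetric] m_def by linarith
  have "coprime N m" unfolding m_def by (rule coprimeI) (metis dvd_add_right_iff dvd_mult)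
  then show "coprime d m" if "0 < d" "d \<le> k" for d
    using coprime_divisors[of d N m m] dvd_fact[of d k] that by (simp add: N_def)
qed

theorem theorem7:
  fixes F :: "'a graph" and G :: "'b graph"
  assumes "simple_graph F" and "verts F \<noteq> {}" and "no_isolated_vertices F"
    and "simple_graph G" and "verts G \<noteq> {}" and "no_isolated_vertices G"
    and "\<nexists>f. graph_hom f G F"
  shows "\<exists>r :: nat \<Rightarrow> real. r \<in> o(\<lambda>n. real n ^ 2) \<and>
           (\<forall>n. real (ex_packing F n G) \<ge>
                  1 / real (card (verts F)) ^ 2 * real n ^ 2 - r n)"
proof -
  define k where "k = card (verts F)"
  \<comment> \<open>\<open>C\<close> bounds the loss of \<open>m\<close> against n / k: 1 for
    rounding down to \<open>n div k\<close>, and \<open>fact k\<close> for passing to a number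
    coprime to everything up to \<open>k\<close>.\<close>
  define C where "C = real (fact k) + 1"
  have C: "C \<ge> 1" by (simp add: C_def)
  have k: "k > 0" using assms(1,2) by (simp add: k_def simple_graph_def card_gt_0_iff)
  have edge: "edges F \<noteq> {}" using assms(2,3) by (auto simp: no_isolated_vertices_def)
  \<comment> \<open>With x = n / k, the left side is (x - C)^2 without its constant term
    C^2.\<close>
  have bound: "(real n / real k)\<^sup>2 - 2 * C * (real n / real k) \<le> real (ex_packing F n G)" for n
  proof (cases "real n / real k < C")
    \<comment> \<open>Here the left side is at most 0. The other case has x - C nonnegative, so the
      inequality x - C \<le> m may be squared.\<close>
    case True
    then have "real n / real k \<le> 2 * C" using C by linarith
    then have "real n / real k * (real n / real k) \<le> 2 * C * (real n / real k)"
      by (intro mult_right_mono) simp_all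
    then show ?thesis by (simp add: power2_eq_square)
  next
    case False
    have "n < (n div k + 1) * k" using dividend_less_div_times[OF k, of n] by simp
    then have "real n < (real (n div k) + 1) * real k"
      by (metis of_nat_1 of_nat_add of_nat_less_iff of_nat_mult)
    then have floor: "real n / real k < real (n div k) + 1"
      using k by (simp add: pos_divide_less_eq)
    then have "n div k > 0" using False C by (cases "n div k") auto
    then obtain m where m: "0 < m" "m \<le> n div k" "n div k < m + fact k"
      and cop: "\<And>d. 0 < d \<Longrightarrow> d \<le> k \<Longrightarrow> coprime d m"
      using exists_large_size_coprime_upto by metis
    have "k * m \<le> k * (n div k)" using m(2) by simp
    then have km: "k * m \<le> n" using times_div_less_eq_dividend[of k n] by linarith
    have "m\<^sup>2 \<le> ex_packing F n G"
      using blowup_packing[OF assms(1,4,7) m(1), of n] km cop ex_packing_ge[OF assms(1) edge]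
      unfolding k_def by (metis less_imp_le)
    then have "(real m)\<^sup>2 \<le> real (ex_packing F n G)"
      by (metis of_nat_le_iff of_nat_power)
    moreover have "real (n div k) < real m + real (fact k)"
      using m(3) by (metis of_nat_add of_nat_less_iff)
    then have "real n / real k - C \<le> real m"
      using floor by (simp add: C_def)
    then have "(real n / real k - C)\<^sup>2 \<le> (real m)\<^sup>2"
      using False by (intro power_mono) auto
    moreover have "(real n / real k)\<^sup>2 - 2 * C * (real n / real k) \<le> (real n / real k - C)\<^sup>2"
      by (simp add: power2_diff mult_ac)
    ultimately show ?thesis by linarith
  qed
  define r where "r n = 2 * C * (real n / real k)" for n
  have "(\<lambda>n. real n) \<in> o(\<lambda>n. real n ^ 2)"
  proof (rule smalloI_tendsto)
    \<comment> \<open>At \<open>n = 0\<close> both sides are 0, since division by zero and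
      \<open>inverse 0\<close> are 0.\<close>
    have "real n / real n ^ 2 = inverse (real n)" for n
      by (cases "n = 0") (simp_all add: power2_eq_square divide_inverse)
    then show "((\<lambda>n. real n / real n ^ 2) \<longlongrightarrow> 0) sequentially"
      using lim_inverse_n[where 'a = real] by simp
    show "\<forall>\<^sub>F n in sequentially. real n ^ 2 \<noteq> 0"
      using eventually_gt_at_top[of 0] by eventually_elim simp
  qed
  moreover have "r = (\<lambda>n. 2 * C / real k * real n)" by (simp add: r_def fun_eq_iff)
  moreover have "2 * C / real k \<noteq> 0" using C k by simp
  ultimately have "r \<in> o(\<lambda>n. real n ^ 2)"
    using landau_o.small.cmult_in_iff[of "2 * C / real k" real] by blast
  moreover have "1 / real (card (verts F)) ^ 2 * real n ^ 2 - r n \<le> real (ex_packing F n G)" for n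
    using bound[of n] by (simp add: r_def k_def power_divide)
  ultimately show ?thesis by blast
qed

end
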